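(* Define $\bar\Omega^i=\{S\subseteq I\setminus\{0\}:\ i\in S,\ |S|\le\bar c\}$ and $\underline\Omega^i=\{S\subseteq I\setminus\{0\}:\ i\notin S,\ |S|\le\bar c\}$ as the sets of feasible assortments that include and exclude product $i\in I\setminus\{0\}$, respectively. Moreover, define $\bar\pi^i=\max_{S\in\bar\Omega^i}\pi(S)$ and $\underline\pi^i=\max_{S\in\underline\Omega^i}\pi(S)$. Then the inequalities $\pi'\le\bar\pi^i+1-x_i$ and $\pi'\le\underline\pi^i+x_i$ are valid to the problem $$\bar z_T=\max\Big\{\delta:\ \sum_{j=1}^n\nu_jx_j(r_j\pi'-\delta)\ge\delta,\ \mathbf x\in X,\ (\boldsymbol\alpha,\boldsymbol\beta)\in A(\mathbf x),\ \delta\in\mathbb R,\ (\mathbf q,\mathbf w,\pi')\in Q_T\Big\}$$ for all $i\in I\setminus\{0\}$.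
   Context: $I=\{0,1,\dots,n\}$, where $0$ is the no-purchase option and $1,\dots,n$ are products with revenues $r_i\ge0$ and weights $\nu_i=e^{u_i}$ ($u_i$ is the mean utility of product $i$). An assortment is a set $S\subseteq I\setminus\{0\}$, and $\bar S=I\setminus(S\cup\{0\})$ is the set of unavailable products. $\bar c$ is the maximum number of products allowed in an assortment, and $\bar u$ is the number of top-priority products in a preference list, assumed to be less than the number of products not included in the assortment. The parameters $p_i^0\ge0$ and $\eta_{ik}\ge0$ satisfy $\eta_{i1}=1$; $\eta_{ik}p_i^0$ is the probability that a customer leaves the store when unavailable product $i$ is in position $k\in\{1,\dots,\bar u\}$ of the list. The worst-case probability of staying in the store is $\pi(S)=\min_{y\in Y(S)}\prod_{k=1}^{\bar u}\big(1-\sum_{i\in\bar S}\eta_{ik}p_i^0y_{ik}\big)$, where $Y(S)$ is the set of $y\in\{0,1\}^{|\bar S|\times\bar u}$ with $\sum_{i\in\bar S}y_{ik}=1$ for all $k\in\{1,\dots,\bar u\}$ and $\sum_{k=1}^{\bar u}y_{ik}\le1$ for all $i\in\bar S$; by convention $\pi(I\setminus\{0\})=1$. Let $\theta(S)=\ln\pi(S)$, $\theta_{\min}=\theta(\emptyset)$ and $\theta_{\max}=0$. The binary vector $\mathbf x$ encodes the assortment $S=\{i\in I\setminus\{0\}:x_i=1\}$, and $X=\{\mathbf x\in\{0,1\}^n:\sum_{i=1}^nx_i\le\bar c\}$. $A(\mathbf x)$ is the set of $\boldsymbol\alpha\in\mathbb R_+^{\bar u}$, $\boldsymbol\beta\in\mathbb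 R_+^n$ with $\alpha_k+(1-x_i)\beta_i\ge-\ln(1-\eta_{ik}p_i^0)(1-x_i)$ for all $i=1,\dots,n$ and $k\in\{1,\dots,\bar u\}$. The problem is the upper-bound problem of an iterative procedure in which $e^{\theta}$ is overestimated by a piecewise-linear function whose breakpoints come from the assortments $S_1^\ast,\dots,S_T^\ast$ found as optimal solutions in the $T$ previous iterations, ordered so that $\theta_{\min}\le\theta(S_1^\ast)\le\dots\le\theta(S_T^\ast)\le0$. Write $\theta_1=\theta_{\min}$, $\theta_{t+1}=\theta(S_t^\ast)$ for $t=1,\dots,T$, and $\theta_{T+2}=\theta_{\max}$. Then $Q_T$ is the feasible set of the following constraints in $\mathbf w\in[0,1]^{T+2}$, $\mathbf q\in\{0,1\}^{T+1}$, $\pi'\in\mathbb R$ (linked with $\mathbf x,\boldsymbol\alpha,\boldsymbol\beta$): $w_1\le q_1$; $w_t\le q_{t-1}+q_t$ for $t\in\{2,\dots,T+1\}$; $w_{T+2}\le q_{T+1}$; $\sum_{t=1}^{T+1}q_t=1$; $\sum_{t=1}^{T+2}w_t=1$; $\sum_{t=1}^{T+2}\theta_tw_t=-\sum_{k=1}^{\bar u}\alpha_k-\sum_{i=1}^n(1-x_i)\beta_i$; and $\pi'\le\sum_{t=1}^{T+2}e^{\theta_t}w_t$.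
   Formalization: "Valid" is read as: no solution of the exact problem (π' ≤ π(S)) is cut off and the result still relaxes it, since some feasible points of the z̄_T problem violate the inequalities; also η_ik p_i^0 < 1 and c̄ ≥ 1 are assumed so that logarithms and maxima exist. *)

theory Defs
  imports Complex_Main
begin

(* Products are 1, ..., num_products; the no-purchase option 0 never occurs as an index.
   Positions in a preference list are 1, ..., num_top. *)

record assort_model =
  num_products :: nat
  revenue :: "nat \<Rightarrow> real"
  mean_utility :: "nat \<Rightarrow> real"
  max_size :: nat
  num_top :: nat
  leave_prob :: "nat \<Rightarrow> real"
  eta :: "nat \<Rightarrow> nat \<Rightarrow> real"

definition products :: "assort_model \<Rightarrow> nat set" where
  "products M = {1..num_products M}"

definition positions :: "assort_model \<Rightarrow> nat set" where
  "positions M = {1..num_top M}"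

definition weight :: "assort_model \<Rightarrow> nat \<Rightarrow> real" where
  "weight M i = exp (mean_utility M i)"

definition unavailable :: "assort_model \<Rightarrow> nat set \<Rightarrow> nat set" where
  "unavailable M S = products M - S"

definition feasible_assortments :: "assort_model \<Rightarrow> nat set set" where
  "feasible_assortments M = {S. S \<subseteq> products M \<and> card S \<le> max_size M}"

(* The strict bound eta i k * p i < 1 makes all logarithms below logarithms of positive numbers.
   1 <= max_size makes the set of feasible assortments containing a given product nonempty. *)

definition valid_model :: "assort_model \<Rightarrow> bool" where
  "valid_model M \<longleftrightarrow>
     1 \<le> num_top M \<and> 1 \<le> max_size M \<and>
     (\<forall>S\<in>feasible_assortments M. num_top M < card (unavailable M S)) \<and>
     (\<forall>i\<in>products M. 0 \<le> revenue M i \<and> 0 \<le> leave_prob M i \<and> eta M i 1 = 1) \<and>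
     (\<forall>i\<in>products M. \<forall>k\<in>positions M. 0 \<le> eta M i k \<and> eta M i k * leave_prob M i < 1)"

(* Matrices are functions; fixing the irrelevant entries to 0 makes this set finite. *)

definition priority_choices :: "assort_model \<Rightarrow> nat set \<Rightarrow> (nat \<Rightarrow> nat \<Rightarrow> real) set" where
  "priority_choices M S =
     {y. (\<forall>i\<in>unavailable M S. \<forall>k\<in>positions M. y i k \<in> {0, 1}) \<and>
         (\<forall>i k. i \<notin> unavailable M S \<or> k \<notin> positions M \<longrightarrow> y i k = 0) \<and>
         (\<forall>k\<in>positions M. (\<Sum>i\<in>unavailable M S. y i k) = 1) \<and>
         (\<forall>i\<in>unavailable M S. (\<Sum>k\<in>positions M. y i k) \<le> 1)}"

definition stay_prob :: "assort_model \<Rightarrow> nat set \<Rightarrow> real" where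
  "stay_prob M S =
     (if unavailable M S = {} then 1
      else Min ((\<lambda>y. \<Prod>k\<in>positions M.
                   1 - (\<Sum>i\<in>unavailable M S. eta M i k * leave_prob M i * y i k))
                ` priority_choices M S))"

definition log_stay :: "assort_model \<Rightarrow> nat set \<Rightarrow> real" where
  "log_stay M S = ln (stay_prob M S)"

definition assortments_with :: "assort_model \<Rightarrow> nat \<Rightarrow> nat set set" where
  "assortments_with M i = {S. S \<subseteq> products M \<and> i \<in> S \<and> card S \<le> max_size M}"

definition assortments_without :: "assort_model \<Rightarrow> nat \<Rightarrow> nat set set" where
  "assortments_without M i = {S. S \<subseteq> products M \<and> i \<notin> S \<and> card S \<le> max_size M}"

definition max_stay_with :: "assort_model \<Rightarrow> nat \<Rightarrow> real" where
  "max_stay_with M i = Max (stay_prob M ` assortments_with M i)"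

definition max_stay_without :: "assort_model \<Rightarrow> nat \<Rightarrow> real" where
  "max_stay_without M i = Max (stay_prob M ` assortments_without M i)"

definition assortment_of :: "assort_model \<Rightarrow> (nat \<Rightarrow> real) \<Rightarrow> nat set" where
  "assortment_of M x = {i\<in>products M. x i = 1}"

definition X_set :: "assort_model \<Rightarrow> (nat \<Rightarrow> real) set" where
  "X_set M = {x. (\<forall>i\<in>products M. x i \<in> {0, 1}) \<and>
                 (\<Sum>i\<in>products M. x i) \<le> real (max_size M)}"

definition A_set :: "assort_model \<Rightarrow> (nat \<Rightarrow> real) \<Rightarrow> ((nat \<Rightarrow> real) \<times> (nat \<Rightarrow> real)) set" where
  "A_set M x =
     {(\<alpha>, \<beta>). (\<forall>k\<in>positions M. 0 \<le> \<alpha> k) \<and> (\<forall>i\<in>products M. 0 \<le> \<beta> i) \<and>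
        (\<forall>i\<in>products M. \<forall>k\<in>positions M.
           \<alpha> k + (1 - x i) * \<beta> i \<ge> - ln (1 - eta M i k * leave_prob M i) * (1 - x i))}"

(* Ss 1, ..., Ss T are the assortments of the previous iterations. *)

definition breakpoint :: "assort_model \<Rightarrow> nat \<Rightarrow> (nat \<Rightarrow> nat set) \<Rightarrow> nat \<Rightarrow> real" where
  "breakpoint M T Ss t =
     (if t = 1 then log_stay M {} else if t = T + 2 then 0 else log_stay M (Ss (t - 1)))"

definition Q_set ::
  "assort_model \<Rightarrow> nat \<Rightarrow> (nat \<Rightarrow> nat set) \<Rightarrow>
   (nat \<Rightarrow> real) \<Rightarrow> (nat \<Rightarrow> real) \<Rightarrow> (nat \<Rightarrow> real) \<Rightarrow>
   ((nat \<Rightarrow> real) \<times> (nat \<Rightarrow> real) \<times> real) set" where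
  "Q_set M T Ss x \<alpha> \<beta> =
     {(q, w, \<pi>').
        (\<forall>t\<in>{1..T+2}. 0 \<le> w t \<and> w t \<le> 1) \<and>
        (\<forall>t\<in>{1..T+1}. q t \<in> {0, 1}) \<and>
        w 1 \<le> q 1 \<and>
        (\<forall>t\<in>{2..T+1}. w t \<le> q (t - 1) + q t) \<and>
        w (T + 2) \<le> q (T + 1) \<and>
        (\<Sum>t=1..T+1. q t) = 1 \<and>
        (\<Sum>t=1..T+2. w t) = 1 \<and>
        (\<Sum>t=1..T+2. breakpoint M T Ss t * w t) =
          - (\<Sum>k\<in>positions M. \<alpha> k) - (\<Sum>i\<in>products M. (1 - x i) * \<beta> i) \<and>
        \<pi>' \<le> (\<Sum>t=1..T+2. exp (breakpoint M T Ss t) * w t)}"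

definition revenue_constraint ::
  "assort_model \<Rightarrow> (nat \<Rightarrow> real) \<Rightarrow> real \<Rightarrow> real \<Rightarrow> bool" where
  "revenue_constraint M x \<delta> \<pi>' \<longleftrightarrow>
     (\<Sum>j\<in>products M. weight M j * x j * (revenue M j * \<pi>' - \<delta>)) \<ge> \<delta>"

(* Feasible set of the upper-bound problem, whose objective is to maximize delta. *)

definition ub_feasible ::
  "assort_model \<Rightarrow> nat \<Rightarrow> (nat \<Rightarrow> nat set) \<Rightarrow>
   ((nat \<Rightarrow> real) \<times> (nat \<Rightarrow> real) \<times> (nat \<Rightarrow> real) \<times> real \<times>
    (nat \<Rightarrow> real) \<times> (nat \<Rightarrow> real) \<times> real) set" where
  "ub_feasible M T Ss =
     {(x, \<alpha>, \<beta>, \<delta>, q, w, \<pi>').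
        revenue_constraint M x \<delta> \<pi>' \<and> x \<in> X_set M \<and> (\<alpha>, \<beta>) \<in> A_set M x \<and>
        (q, w, \<pi>') \<in> Q_set M T Ss x \<alpha> \<beta>}"

(* The problem that the upper-bound problem relaxes: pi' is bounded by the worst-case staying
   probability itself, not by its piecewise-linear overestimate. *)

definition exact_feasible :: "assort_model \<Rightarrow> (nat \<Rightarrow> real) \<Rightarrow> real \<Rightarrow> real \<Rightarrow> bool" where
  "exact_feasible M x \<delta> \<pi>' \<longleftrightarrow>
     revenue_constraint M x \<delta> \<pi>' \<and> x \<in> X_set M \<and> \<pi>' \<le> stay_prob M (assortment_of M x)"

(* An inequality C in (x, pi') is valid for the upper-bound problem if adding it removes no
   point representing a solution of the exact problem, and the result is still a relaxation of
   the exact problem (so its optimal delta is still an upper bound). The points of ub_feasible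
   with pi' above the worst-case staying probability are artefacts of the overestimation;
   a valid inequality may cut them off. *)

definition valid_inequality ::
  "assort_model \<Rightarrow> nat \<Rightarrow> (nat \<Rightarrow> nat set) \<Rightarrow> ((nat \<Rightarrow> real) \<Rightarrow> real \<Rightarrow> bool) \<Rightarrow> bool" where
  "valid_inequality M T Ss C \<longleftrightarrow>
     (\<forall>(x, \<alpha>, \<beta>, \<delta>, q, w, \<pi>') \<in> ub_feasible M T Ss.
        exact_feasible M x \<delta> \<pi>' \<longrightarrow> C x \<pi>') \<and>
     (\<forall>x \<delta> \<pi>'. exact_feasible M x \<delta> \<pi>' \<longrightarrow>
        (\<exists>\<alpha> \<beta> q w. (x, \<alpha>, \<beta>, \<delta>, q, w, \<pi>') \<in> ub_feasible M T Ss \<and> C x \<pi>'))"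

end

theory Submission
  imports Defs "HOL-Combinatorics.Cycles"
begin

text \<open>
  Two independent facts make the inequalities valid. First, a point of the exact problem satisfies
  them: its \<open>\<pi>'\<close> is at most the staying probability of its own assortment \<open>S\<close>, which is one of the
  assortments over which the relevant maximum is taken, or else the right-hand side exceeds that
  maximum by 1, and staying probabilities lie in \<open>(0, 1]\<close>.

  Second, every point of the exact problem extends to a point of the upper-bound problem, so the
  inequalities leave a relaxation of the exact problem. This is the substantial part. With costs
  \<open>c i k = - ln (1 - \<eta>\<^sub>i\<^sub>k p\<^sub>i)\<close>, minimizing the product that defines \<open>\<pi>(S)\<close> is maximizing the total
  cost of an assignment of distinct unavailable products to positions, and the constraints of \<open>A(x)\<close>
  are those of the dual linear program. Strong duality (\<open>assignment_duality\<close>) yields an assignment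
  \<open>f\<close> and dual values whose negated total \<open>v\<close> is at least minus the cost of \<open>f\<close>, that is, the
  probability of staying under \<open>f\<close> is at most \<open>exp v\<close>. As \<open>f\<close> competes in the minima
  defining \<open>\<pi>(S)\<close> and \<open>\<pi>({})\<close>, both \<open>\<theta>(S)\<close> and \<open>\<theta>\<^sub>m\<^sub>i\<^sub>n\<close> are at most \<open>v\<close>.
  Hence \<open>v\<close> lies between the outer breakpoints, and interpolating
  there between two adjacent breakpoints (\<open>piecewise_linear_overestimate\<close>) gives a value at least
  \<open>exp v \<ge> \<pi>(S) \<ge> \<pi>'\<close> by convexity of \<open>exp\<close>.

  Strong duality is obtained by fixing an optimal assignment and taking as dual prices the largest
  weights of simple exchange paths that end in a product; optimality says that no
  exchange cycle gains, which is what makes these prices feasible.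
\<close>

section \<open>Potentials for weights without positive cycles\<close>

fun path_weight :: "('a \<Rightarrow> 'a \<Rightarrow> real) \<Rightarrow> 'a list \<Rightarrow> real" where
  "path_weight w (u # v # vs) = w u v + path_weight w (v # vs)"
| "path_weight w vs = 0"

lemma path_weight_split:
  "path_weight w (us @ v # vs) = path_weight w (us @ [v]) + path_weight w (v # vs)"
  by (induction w us rule: path_weight.induct) (cases vs; simp)+

lemma path_weight_zip:
  "path_weight w (u # vs @ [v]) = sum_list (map2 w (u # vs) (vs @ [v]))"
  by (induction vs arbitrary: u) simp_all

text \<open>
  A simple cycle is a cyclic permutation of its vertices, so conditions on permutations, which is
  how optimality of an assignment is expressed, apply to cycles of exchanges.
\<close>

lemma cycle_weight_as_permutation:
  assumes "distinct (u # vs)"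
  shows "path_weight w (u # vs @ [u]) =
    (\<Sum>z\<in>set (u # vs). w z (cycle_of_list (u # vs) z))"
proof -
  let ?c = "cycle_of_list (u # vs)"
  have "map ?c (u # vs) = vs @ [u]"
    using cyclic_rotation[OF assms, of 1] by simp
  hence "path_weight w (u # vs @ [u]) = sum_list (map2 w (u # vs) (map ?c (u # vs)))"
    by (simp only: path_weight_zip)
  also have "map2 w (u # vs) (map ?c (u # vs)) = map (\<lambda>z. w z (?c z)) (u # vs)"
    by (simp only: zip_map2 zip_same_conv_map map_map) simp
  also have "sum_list \<dots> = (\<Sum>z\<in>set (u # vs). w z (?c z))"
    using assms by (rule sum_list_distinct_conv_sum_set)
  finally show ?thesis .
qed

text \<open>
  The potential of \<open>v\<close> is the largest weight of a simple path ending in \<open>v\<close>. Appending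
  an edge \<open>u \<rightarrow> v\<close> to an optimal path for \<open>u\<close> gives a simple path, or a path into \<open>v\<close>
  followed by a simple cycle through \<open>v\<close>; the cycle has nonpositive weight and can be dropped.
\<close>

lemma potential_exists:
  fixes w :: "'a \<Rightarrow> 'a \<Rightarrow> real"
  assumes fin: "finite V"
    and loop: "\<And>v. v \<in> V \<Longrightarrow> w v v = 0"
    and perm: "\<And>\<tau>. \<tau> permutes V \<Longrightarrow> (\<Sum>v\<in>V. w v (\<tau> v)) \<le> 0"
  obtains p where "\<And>u v. u \<in> V \<Longrightarrow> v \<in> V \<Longrightarrow> p u + w u v \<le> p v"
proof -
  define paths where "paths v = {vs. set (vs @ [v]) \<subseteq> V \<and> distinct (vs @ [v])}" for v
  define p where "p v = Max ((\<lambda>vs. path_weight w (vs @ [v])) ` paths v)" for v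
  have fin_paths: "finite (paths v)" for v
  proof (rule finite_subset)
    show "paths v \<subseteq> {vs. set vs \<subseteq> V \<and> distinct vs}"
      unfolding paths_def by auto
    show "finite {vs. set vs \<subseteq> V \<and> distinct vs}"
      using fin by (rule finite_subset_distinct)
  qed
  have path_le: "path_weight w (vs @ [v]) \<le> p v" if "vs \<in> paths v" for vs v
    unfolding p_def using fin_paths that by (intro Max_ge finite_imageI imageI)
  have cycle: "path_weight w (u # vs @ [u]) \<le> 0"
    if d: "distinct (u # vs)" and s: "set (u # vs) \<subseteq> V" for u vs
  proof -
    let ?c = "cycle_of_list (u # vs)"
    \<comment> \<open>Vertices off the cycle are fixed points and contribute their loop, which weighs 0.\<close>
    have "(\<Sum>z\<in>set (u # vs). w z (?c z)) = (\<Sum>z\<in>V. w z (?c z))"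
    proof (rule sum.mono_neutral_left[OF fin s], rule ballI)
      fix z assume z: "z \<in> V - set (u # vs)"
      hence "?c z = z" by (intro id_outside_supp) blast
      thus "w z (?c z) = 0" using z loop by simp
    qed
    moreover have "?c permutes V"
      using cycle_permutes s by (rule permutes_subset)
    ultimately show ?thesis
      using cycle_weight_as_permutation[OF d, of w] perm by simp
  qed
  have "p u + w u v \<le> p v" if u: "u \<in> V" and v: "v \<in> V" for u v
  proof -
    have "[] \<in> paths u" using u by (simp add: paths_def)
    hence "p u \<in> (\<lambda>vs. path_weight w (vs @ [u])) ` paths u"
      unfolding p_def using fin_paths by (intro Max_in) auto
    then obtain us where us: "us \<in> paths u" and pu: "p u = path_weight w (us @ [u])"
      by blast
    have ext: "p u + w u v = path_weight w (us @ [u] @ [v])"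
      using path_weight_split[of w us u "[v]"] pu by simp
    show ?thesis
    proof (cases "v \<in> set (us @ [u])")
      case False
      hence "us @ [u] \<in> paths v" using us v by (simp add: paths_def)
      from path_le[OF this] show ?thesis using ext by simp
    next
      case True
      then obtain xs ys where xy: "us @ [u] = xs @ v # ys"
        by (meson split_list)
      have dist: "distinct (xs @ v # ys)" and sub: "set (xs @ v # ys) \<subseteq> V"
        using us unfolding xy[symmetric] paths_def by auto
      have "us @ [u] @ [v] = xs @ v # (ys @ [v])"
        using xy by (metis append_Cons append_assoc)
      hence "p u + w u v = path_weight w (xs @ [v]) + path_weight w (v # ys @ [v])"
        using ext path_weight_split by metis
      moreover have "path_weight w (v # ys @ [v]) \<le> 0"
        using dist sub by (intro cycle) auto
      moreover have "xs \<in> paths v"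
        using dist sub by (auto simp: paths_def)
      note path_le[OF this]
      ultimately show ?thesis by linarith
    qed
  qed
  thus ?thesis using that by blast
qed

section \<open>Duality for the assignment problem\<close>

text \<open>
  Let \<open>\<sigma>\<close> be an optimal permutation. Complementary slackness forces \<open>a u = c (\<sigma> u) u - b (\<sigma> u)\<close>,
  and then dual feasibility for \<open>u\<close> and \<open>\<sigma> v\<close> reads \<open>b (\<sigma> u) + w u v \<le> b (\<sigma> v)\<close>, where \<open>w u v\<close>
  is the gain when \<open>u\<close> switches to the item of \<open>v\<close>. Such prices \<open>b\<close> are potentials,
  available because no permutation improves on \<open>\<sigma>\<close>.
\<close>

lemma square_assignment_duality:
  fixes c :: "'a \<Rightarrow> 'a \<Rightarrow> real"
  assumes fin: "finite U" and ne: "U \<noteq> {}"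
    and nonneg: "\<And>i u. i \<in> U \<Longrightarrow> u \<in> U \<Longrightarrow> 0 \<le> c i u"
  obtains \<sigma> a b where "\<sigma> permutes U"
    and "\<And>u. u \<in> U \<Longrightarrow> 0 \<le> a u" and "\<And>i. i \<in> U \<Longrightarrow> 0 \<le> b i"
    and "\<And>i u. i \<in> U \<Longrightarrow> u \<in> U \<Longrightarrow> c i u \<le> a u + b i"
    and "sum a U + sum b U = (\<Sum>u\<in>U. c (\<sigma> u) u)"
proof -
  let ?val = "\<lambda>\<sigma>. \<Sum>u\<in>U. c (\<sigma> u) u"
  define P where "P = {\<sigma>. \<sigma> permutes U}"
  have P: "finite P" "id \<in> P"
    using finite_permutations[OF fin] permutes_id[of U] by (simp_all add: P_def)
  hence "Max (?val ` P) \<in> ?val ` P" by (intro Max_in) auto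
  then obtain \<sigma> where \<sigma>P: "\<sigma> \<in> P" and max: "Max (?val ` P) = ?val \<sigma>" by blast
  have \<sigma>: "\<sigma> permutes U" using \<sigma>P by (simp add: P_def)
  have opt: "?val \<tau> \<le> ?val \<sigma>" if "\<tau> permutes U" for \<tau>
    unfolding max[symmetric] using P that by (intro Max_ge finite_imageI imageI) (simp_all add: P_def)
  define w where "w u v = c (\<sigma> v) u - c (\<sigma> u) u" for u v
  obtain p where p: "\<And>u v. u \<in> U \<Longrightarrow> v \<in> U \<Longrightarrow> p u + w u v \<le> p v"
  proof (rule potential_exists[OF fin, of w])
    fix \<tau> assume "\<tau> permutes U"
    hence "?val (\<sigma> \<circ> \<tau>) \<le> ?val \<sigma>"
      using \<sigma> by (intro opt permutes_compose)
    thus "(\<Sum>v\<in>U. w v (\<tau> v)) \<le> 0"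
      by (simp add: w_def sum_subtractf)
  qed (auto simp: w_def)
  \<comment> \<open>Shifting the least price to 0 keeps feasibility and the total, and makes \<open>a\<close> nonnegative:
      at the item of price 0, feasibility reads \<open>0 \<le> c i u \<le> a u\<close>.\<close>
  define m where "m = Min (p ` U)"
  have "m \<in> p ` U" unfolding m_def using fin ne by (intro Min_in) auto
  then obtain u0 where u0: "u0 \<in> U" "p u0 = m" by blast
  have m: "m \<le> p u" if "u \<in> U" for u
    unfolding m_def using fin that by (intro Min_le) auto
  define a where "a u = c (\<sigma> u) u - (p u - m)" for u
  define b where "b i = p (inv \<sigma> i) - m" for i
  have in_U: "\<sigma> u \<in> U" "inv \<sigma> u \<in> U" if "u \<in> U" for u
    using \<sigma> that permutes_in_image permutes_inv by metis+
  have inv: "\<sigma> (inv \<sigma> i) = i" "inv \<sigma> (\<sigma> i) = i" for i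
    using \<sigma> by (simp_all add: permutes_inverses)
  show ?thesis
  proof (rule that[OF \<sigma>])
    fix u assume u: "u \<in> U"
    have "p u + w u u0 \<le> m" using p[OF u u0(1)] u0 by simp
    thus "0 \<le> a u"
      using nonneg[OF in_U(1)[OF u0(1)] u] by (simp add: a_def w_def)
  next
    fix i assume "i \<in> U"
    thus "0 \<le> b i" using m in_U by (simp add: b_def)
  next
    fix i u assume "i \<in> U" "u \<in> U"
    thus "c i u \<le> a u + b i"
      using p[of u "inv \<sigma> i"] in_U by (simp add: a_def b_def w_def inv)
  next
    have "sum b U = (\<Sum>u\<in>U. b (\<sigma> u))"
      using sum.permute[OF \<sigma>, of b] by (simp add: o_def)
    thus "sum a U + sum b U = (\<Sum>u\<in>U. c (\<sigma> u) u)"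
      by (simp add: a_def b_def inv sum_subtractf)
  qed
qed

text \<open>
  The rectangular case reduces to the square one: an arbitrary injection \<open>e\<close> names each position by an
  item, and the remaining items serve as dummy positions of cost 0. Discarding the
  dummies' dual values can only lower the dual total, so an inequality comes out, which is the
  nontrivial direction of strong duality.
\<close>

lemma assignment_duality:
  fixes c :: "'i \<Rightarrow> 'k \<Rightarrow> real"
  assumes "finite U" and "finite K" and ne: "U \<noteq> {}" and card: "card K \<le> card U"
    and nonneg: "\<And>i k. i \<in> U \<Longrightarrow> k \<in> K \<Longrightarrow> 0 \<le> c i k"
  obtains f \<alpha> \<beta> where "inj_on f K" and "f ` K \<subseteq> U"
    and "\<And>k. k \<in> K \<Longrightarrow> 0 \<le> \<alpha> k" and "\<And>i. i \<in> U \<Longrightarrow> 0 \<le> \<beta> i"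
    and "\<And>i k. i \<in> U \<Longrightarrow> k \<in> K \<Longrightarrow> c i k \<le> \<alpha> k + \<beta> i"
    and "sum \<alpha> K + sum \<beta> U \<le> (\<Sum>k\<in>K. c (f k) k)"
proof -
  obtain e where e: "inj_on e K" "e ` K \<subseteq> U"
    using card_le_inj[OF assms(2,1) card] by blast
  define d where "d i u = (if u \<in> e ` K then c i (inv_into K e u) else 0)" for i u
  have d_e: "d i (e k) = c i k" if "k \<in> K" for i k
    using that e by (simp add: d_def)
  have "0 \<le> d i u" if "i \<in> U" "u \<in> U" for i u
    using that nonneg by (auto simp: d_def inv_into_into)
  then obtain \<sigma> a b where \<sigma>: "\<sigma> permutes U"
    and a: "\<And>u. u \<in> U \<Longrightarrow> 0 \<le> a u" and b: "\<And>i. i \<in> U \<Longrightarrow> 0 \<le> b i"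
    and ab: "\<And>i u. i \<in> U \<Longrightarrow> u \<in> U \<Longrightarrow> d i u \<le> a u + b i"
    and sum_ab: "sum a U + sum b U = (\<Sum>u\<in>U. d (\<sigma> u) u)"
    using square_assignment_duality[OF \<open>finite U\<close> ne, of d] by blast
  show ?thesis
  proof (rule that[of "\<sigma> \<circ> e" "a \<circ> e" b])
    show "inj_on (\<sigma> \<circ> e) K"
      using e(1) permutes_inj_on[OF \<sigma>] by (rule comp_inj_on)
    show "(\<sigma> \<circ> e) ` K \<subseteq> U"
      using e(2) permutes_in_image[OF \<sigma>] by auto
    have "sum (a \<circ> e) K = sum a (e ` K)"
      using sum.reindex[OF e(1), of a] by simp
    also have "\<dots> \<le> sum a U"
      using \<open>finite U\<close> e(2) a by (intro sum_mono2) auto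
    also have "sum a U + sum b U = (\<Sum>u\<in>e ` K. d (\<sigma> u) u)"
      unfolding sum_ab using \<open>finite U\<close> e(2)
      by (intro sum.mono_neutral_right) (auto simp: d_def)
    also have "\<dots> = (\<Sum>k\<in>K. d (\<sigma> (e k)) (e k))"
      using sum.reindex[OF e(1), of "\<lambda>u. d (\<sigma> u) u"] by simp
    also have "\<dots> = (\<Sum>k\<in>K. c ((\<sigma> \<circ> e) k) k)"
      by (intro sum.cong) (simp_all add: d_e)
    finally show "sum (a \<circ> e) K + sum b U \<le> (\<Sum>k\<in>K. c ((\<sigma> \<circ> e) k) k)"
      by simp
    show "c i k \<le> (a \<circ> e) k + b i" if "i \<in> U" "k \<in> K" for i k
      using ab[of i "e k"] that e(2) d_e by auto
  qed (use a b e in auto)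
qed

section \<open>The piecewise-linear overestimate of the exponential\<close>

text \<open>
  The weights interpolate \<open>v\<close> between \<open>\<theta> s\<close> and its successor, where \<open>s \<le> T + 1\<close> is
  the largest index with \<open>\<theta> s \<le> v\<close>. That the interpolated exponential is at least \<open>exp v\<close> follows for any weights of mean
  \<open>v\<close> from the tangent bound \<open>exp v * (1 + \<theta> t - v) \<le> exp (\<theta> t)\<close>.
\<close>

lemma piecewise_linear_overestimate:
  fixes \<theta> :: "nat \<Rightarrow> real"
  assumes lower: "\<theta> 1 \<le> v" and upper: "v \<le> \<theta> (T + 2)"
  obtains q w :: "nat \<Rightarrow> real" where
    "\<forall>t\<in>{1..T+2}. 0 \<le> w t \<and> w t \<le> 1" "\<forall>t\<in>{1..T+1}. q t \<in> {0, 1}"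
    "w 1 \<le> q 1" "\<forall>t\<in>{2..T+1}. w t \<le> q (t - 1) + q t" "w (T + 2) \<le> q (T + 1)"
    "(\<Sum>t=1..T+1. q t) = 1" "(\<Sum>t=1..T+2. w t) = 1"
    "(\<Sum>t=1..T+2. \<theta> t * w t) = v"
    "exp v \<le> (\<Sum>t=1..T+2. exp (\<theta> t) * w t)"
proof -
  define s where "s = Max {t\<in>{1..T+1}. \<theta> t \<le> v}"
  have s_in: "s \<in> {t\<in>{1..T+1}. \<theta> t \<le> v}"
    unfolding s_def using lower by (intro Max_in) auto
  have above: "v \<le> \<theta> (s + 1)"
  proof (rule ccontr)
    assume less: "\<not> v \<le> \<theta> (s + 1)"
    hence "s + 1 \<noteq> T + 2" using upper by metis
    hence "s + 1 \<in> {t\<in>{1..T+1}. \<theta> t \<le> v}" using s_in less by auto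
    hence "s + 1 \<le> s" unfolding s_def by (intro Max_ge) auto
    thus False by simp
  qed
  \<comment> \<open>If the two breakpoints coincide, both equal \<open>v\<close> and any \<open>l\<close> in \<open>[0, 1]\<close> would do.\<close>
  define l where "l = (if \<theta> (s + 1) = \<theta> s then 0 else (v - \<theta> s) / (\<theta> (s + 1) - \<theta> s))"
  have l: "0 \<le> l" "l \<le> 1" "\<theta> s * (1 - l) + \<theta> (s + 1) * l = v"
  proof -
    show "0 \<le> l" "l \<le> 1" using s_in above by (auto simp: l_def divide_simps)
    show "\<theta> s * (1 - l) + \<theta> (s + 1) * l = v"
    proof (cases "\<theta> (s + 1) = \<theta> s")
      case True
      thus ?thesis using s_in above by (simp add: l_def)
    next
      case False
      hence "l * (\<theta> (s + 1) - \<theta> s) = v - \<theta> s" by (simp add: l_def)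
      thus ?thesis by (simp add: algebra_simps)
    qed
  qed
  define q :: "nat \<Rightarrow> real" where "q t = (if t = s then 1 else 0)" for t
  define w where "w t = (if t = s then 1 - l else 0) + (if t = s + 1 then l else 0)" for t
  have sum_w: "(\<Sum>t=1..T+2. g t * w t) = g s * (1 - l) + g (s + 1) * l" for g :: "nat \<Rightarrow> real"
  proof -
    have "(\<Sum>t=1..T+2. g t * w t) =
        (\<Sum>t=1..T+2. if t = s then g t * (1 - l) else 0)
        + (\<Sum>t=1..T+2. if t = s + 1 then g t * l else 0)"
      unfolding sum.distrib[symmetric] by (intro sum.cong) (auto simp: w_def)
    thus ?thesis using s_in by (auto simp: sum.delta)
  qed
  have mean: "(\<Sum>t=1..T+2. \<theta> t * w t) = v" and total: "(\<Sum>t=1..T+2. w t) = 1"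
    using sum_w[of \<theta>] sum_w[of "\<lambda>_. 1"] l(3) by simp_all
  show ?thesis
  proof (rule that[of w q])
    show bounds: "\<forall>t\<in>{1..T+2}. 0 \<le> w t \<and> w t \<le> 1"
      using l by (auto simp: w_def)
    show "\<forall>t\<in>{1..T+1}. q t \<in> {0, 1}" by (simp add: q_def)
    show "w 1 \<le> q 1" "w (T + 2) \<le> q (T + 1)" "\<forall>t\<in>{2..T+1}. w t \<le> q (t - 1) + q t"
      using s_in l by (auto simp: w_def q_def)
    show "(\<Sum>t=1..T+1. q t) = 1"
      using s_in by (simp add: q_def sum.delta)
    have "exp v * (1 + \<theta> t - v) \<le> exp (\<theta> t)" for t
      using mult_left_mono[OF exp_ge_add_one_self[of "\<theta> t - v"], of "exp v"]
      by (simp add: exp_diff algebra_simps)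
    hence "(\<Sum>t=1..T+2. exp v * (1 + \<theta> t - v) * w t) \<le> (\<Sum>t=1..T+2. exp (\<theta> t) * w t)"
      using bounds by (intro sum_mono mult_right_mono) auto
    moreover have "(\<Sum>t=1..T+2. exp v * (1 + \<theta> t - v) * w t)
        = exp v * ((1 - v) * (\<Sum>t=1..T+2. w t) + (\<Sum>t=1..T+2. \<theta> t * w t))"
      unfolding sum_distrib_left sum.distrib[symmetric]
      by (intro sum.cong) (simp_all add: algebra_simps)
    ultimately show "exp v \<le> (\<Sum>t=1..T+2. exp (\<theta> t) * w t)"
      using mean total by simp
  qed (use mean total in auto)
qed

section \<open>Staying probabilities\<close>

definition choice_prob :: "assort_model \<Rightarrow> nat set \<Rightarrow> (nat \<Rightarrow> nat \<Rightarrow> real) \<Rightarrow> real" where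
  "choice_prob M S y = (\<Prod>k\<in>positions M.
     1 - (\<Sum>i\<in>unavailable M S. eta M i k * leave_prob M i * y i k))"

lemma finite_index_sets: "finite (products M)" "finite (positions M)" "finite (unavailable M S)"
  by (simp_all add: products_def positions_def unavailable_def)

lemma stay_prob_Min:
  assumes "valid_model M" "S \<in> feasible_assortments M"
  shows "stay_prob M S = Min (choice_prob M S ` priority_choices M S)"
proof -
  have "num_top M < card (unavailable M S)" using assms by (simp add: valid_model_def)
  hence "unavailable M S \<noteq> {}" by auto
  thus ?thesis by (simp add: stay_prob_def choice_prob_def[abs_def])
qed

text \<open>A priority choice is a 0/1 matrix vanishing outside a finite rectangle, hence determined by the
  set of its 1-entries.\<close>

lemma finite_priority_choices: "finite (priority_choices M S)"
proof (rule finite_subset)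
  let ?g = "\<lambda>R i k. if (i, k) \<in> R then 1 else 0 :: real"
  show "priority_choices M S \<subseteq> ?g ` Pow (unavailable M S \<times> positions M)"
  proof
    fix y assume y: "y \<in> priority_choices M S"
    let ?R = "{(i, k). i \<in> unavailable M S \<and> k \<in> positions M \<and> y i k = 1}"
    have "y = ?g ?R" using y by (fastforce simp: priority_choices_def intro!: ext)
    thus "y \<in> ?g ` Pow (unavailable M S \<times> positions M)"
      by (intro image_eqI[of _ _ ?R]) auto
  qed
  show "finite (?g ` Pow (unavailable M S \<times> positions M))"
    by (simp add: finite_index_sets)
qed

definition injection_choice :: "assort_model \<Rightarrow> (nat \<Rightarrow> nat) \<Rightarrow> nat \<Rightarrow> nat \<Rightarrow> real" where
  "injection_choice M f i k = (if k \<in> positions M \<and> f k = i then 1 else 0)"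

lemma injection_priority:
  assumes "inj_on f (positions M)" and "f ` positions M \<subseteq> unavailable M S"
  shows "injection_choice M f \<in> priority_choices M S"
    and "choice_prob M S (injection_choice M f)
      = (\<Prod>k\<in>positions M. 1 - eta M (f k) k * leave_prob M (f k))"
proof -
  have row: "(\<Sum>i\<in>unavailable M S. g i * injection_choice M f i k) = g (f k)"
    if "k \<in> positions M" for g :: "nat \<Rightarrow> real" and k
  proof -
    have "(\<Sum>i\<in>unavailable M S. g i * injection_choice M f i k)
        = (\<Sum>i\<in>unavailable M S. if f k = i then g i else 0)"
      using that by (intro sum.cong) (auto simp: injection_choice_def)
    thus ?thesis using that assms(2) finite_index_sets(3) by (auto simp: sum.delta)
  qed
  have column: "(\<Sum>k\<in>positions M. injection_choice M f i k) \<le> 1" for i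
  proof (cases "\<exists>k\<in>positions M. f k = i")
    case True
    then obtain k where k: "k \<in> positions M" "f k = i" by blast
    have "(\<Sum>k'\<in>positions M. injection_choice M f i k')
        = (\<Sum>k'\<in>positions M. if k' = k then 1 else 0)"
      using k inj_onD[OF assms(1)] by (intro sum.cong) (auto simp: injection_choice_def)
    thus ?thesis using k finite_index_sets(2) by (simp add: sum.delta)
  next
    case False
    hence "(\<Sum>k\<in>positions M. injection_choice M f i k) = 0"
      by (intro sum.neutral) (auto simp: injection_choice_def)
    thus ?thesis by simp
  qed
  have "injection_choice M f i k = 0" if "i \<notin> unavailable M S \<or> k \<notin> positions M" for i k
    using that assms(2) by (auto simp: injection_choice_def)
  moreover have "injection_choice M f i k \<in> {0, 1}" for i k
    by (simp add: injection_choice_def)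
  ultimately show "injection_choice M f \<in> priority_choices M S"
    using row[of _ "\<lambda>_. 1"] column by (simp add: priority_choices_def)
  show "choice_prob M S (injection_choice M f)
      = (\<Prod>k\<in>positions M. 1 - eta M (f k) k * leave_prob M (f k))"
    unfolding choice_prob_def by (intro prod.cong) (simp_all add: row)
qed

text \<open>
  Each position's staying probability is an average of the numbers \<open>1 - \<eta>\<^sub>i\<^sub>k p\<^sub>i\<close>, which are positive
  and at most 1, with the entries of column \<open>k\<close> of \<open>y\<close> as weights.
\<close>

lemma choice_prob_bounds:
  assumes M: "valid_model M" and y: "y \<in> priority_choices M S"
  shows "0 < choice_prob M S y" and "choice_prob M S y \<le> 1"
proof -
  let ?U = "unavailable M S"
  have factor: "0 < 1 - (\<Sum>i\<in>?U. eta M i k * leave_prob M i * y i k)"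
      "1 - (\<Sum>i\<in>?U. eta M i k * leave_prob M i * y i k) \<le> 1"
    if k: "k \<in> positions M" for k
  proof -
    let ?a = "\<lambda>i. eta M i k * leave_prob M i"
    have a: "0 \<le> ?a i" "?a i < 1" if "i \<in> ?U" for i
      using M k that by (auto simp: valid_model_def unavailable_def)
    have y0: "0 \<le> y i k" if "i \<in> ?U" for i
      using y k that by (force simp: priority_choices_def)
    have sum1: "(\<Sum>i\<in>?U. y i k) = 1"
      using y k by (simp add: priority_choices_def)
    have "0 \<le> (\<Sum>i\<in>?U. ?a i * y i k)"
      by (intro sum_nonneg mult_nonneg_nonneg[OF a(1) y0])
    thus "1 - (\<Sum>i\<in>?U. ?a i * y i k) \<le> 1" by simp
    have eq: "1 - (\<Sum>i\<in>?U. ?a i * y i k) = (\<Sum>i\<in>?U. (1 - ?a i) * y i k)"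
      by (simp add: left_diff_distrib sum_subtractf sum1)
    have terms: "0 \<le> (1 - ?a i) * y i k" if "i \<in> ?U" for i
      using a[OF that] y0[OF that] by simp
    have "(\<Sum>i\<in>?U. (1 - ?a i) * y i k) \<noteq> 0"
    proof
      assume "(\<Sum>i\<in>?U. (1 - ?a i) * y i k) = 0"
      hence "\<forall>i\<in>?U. (1 - ?a i) * y i k = 0"
        using terms finite_index_sets(3) by (subst (asm) sum_nonneg_eq_0_iff) auto
      hence "\<forall>i\<in>?U. y i k = 0" using a by fastforce
      thus False using sum1 by simp
    qed
    moreover have "0 \<le> (\<Sum>i\<in>?U. (1 - ?a i) * y i k)"
      using terms by (intro sum_nonneg)
    ultimately show "0 < 1 - (\<Sum>i\<in>?U. ?a i * y i k)"
      unfolding eq by simp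
  qed
  show "0 < choice_prob M S y"
    unfolding choice_prob_def using factor by (intro prod_pos)
  show "choice_prob M S y \<le> 1"
    unfolding choice_prob_def using factor less_imp_le by (intro prod_le_1) blast
qed

lemma stay_prob_le_choice:
  assumes "valid_model M" "S \<in> feasible_assortments M" "y \<in> priority_choices M S"
  shows "stay_prob M S \<le> choice_prob M S y"
  unfolding stay_prob_Min[OF assms(1,2)]
  using finite_priority_choices assms(3) by (intro Min_le) auto

lemma stay_prob_bounds:
  assumes M: "valid_model M" and S: "S \<in> feasible_assortments M"
  shows "0 < stay_prob M S" and "stay_prob M S \<le> 1"
proof -
  have "card (positions M) \<le> card (unavailable M S)"
    using M S by (fastforce simp: valid_model_def positions_def)
  then obtain f where "inj_on f (positions M)" "f ` positions M \<subseteq> unavailable M S"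
    using card_le_inj[OF finite_index_sets(2,3)] by blast
  hence "priority_choices M S \<noteq> {}" using injection_priority(1) by blast
  hence "stay_prob M S \<in> choice_prob M S ` priority_choices M S"
    unfolding stay_prob_Min[OF M S] using finite_priority_choices by (intro Min_in) auto
  thus "0 < stay_prob M S" "stay_prob M S \<le> 1"
    using choice_prob_bounds[OF M] by auto
qed

lemma assortment_of_feasible:
  assumes "x \<in> X_set M"
  shows "assortment_of M x \<in> feasible_assortments M"
proof -
  have "(\<Sum>i\<in>products M. x i) = (\<Sum>i\<in>products M. if x i = 1 then 1 else 0)"
    using assms by (intro sum.cong) (auto simp: X_set_def)
  also have "\<dots> = real (card (assortment_of M x))"
    using finite_index_sets(1) by (simp add: assortment_of_def sum.If_cases Int_def)
  finally show ?thesis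
    using assms by (auto simp: X_set_def feasible_assortments_def assortment_of_def)
qed

section \<open>The upper-bound problem relaxes the exact problem\<close>

text \<open>
  The assignment \<open>f\<close> from duality ranges over products unavailable under \<open>S\<close>, which are also unavailable
  under the empty assortment. It is therefore a competitor in the minima for both, so the single estimate
  \<open>exp v \<ge> probability under f\<close> bounds \<open>\<pi>(S)\<close> and places \<open>v\<close> above the lowest breakpoint.
\<close>

lemma dual_certificate:
  assumes M: "valid_model M" and x: "x \<in> X_set M"
  obtains \<alpha> \<beta> v where "(\<alpha>, \<beta>) \<in> A_set M x"
    and "v = - (\<Sum>k\<in>positions M. \<alpha> k) - (\<Sum>i\<in>products M. (1 - x i) * \<beta> i)"
    and "log_stay M {} \<le> v" and "v \<le> 0"
    and "stay_prob M (assortment_of M x) \<le> exp v"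
proof -
  define S where "S = assortment_of M x"
  let ?U = "unavailable M S" and ?K = "positions M"
  let ?a = "\<lambda>i k. eta M i k * leave_prob M i"
  let ?c = "\<lambda>i k. - ln (1 - ?a i k)"
  have S: "S \<in> feasible_assortments M" and empty: "{} \<in> feasible_assortments M"
    using assortment_of_feasible[OF x] by (simp_all add: S_def feasible_assortments_def)
  have card: "card ?K < card ?U"
    using M S by (fastforce simp: valid_model_def positions_def)
  hence ne: "?U \<noteq> {}" by auto
  have U_iff: "i \<in> ?U \<longleftrightarrow> x i = 0" "x i \<in> {0, 1}" if "i \<in> products M" for i
    using x that by (auto simp: S_def unavailable_def assortment_of_def X_set_def)
  have U_sub: "?U \<subseteq> products M" "?U \<subseteq> unavailable M {}"
    by (auto simp: unavailable_def)
  have a: "0 \<le> ?a i k" "?a i k < 1" if "i \<in> products M" "k \<in> ?K" for i k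
    using M that by (auto simp: valid_model_def)
  have "0 \<le> ?c i k" if "i \<in> ?U" "k \<in> ?K" for i k
    using a[of i k] that U_sub by auto
  then obtain f \<alpha> b where f: "inj_on f ?K" "f ` ?K \<subseteq> ?U"
    and \<alpha>: "\<And>k. k \<in> ?K \<Longrightarrow> 0 \<le> \<alpha> k" and b: "\<And>i. i \<in> ?U \<Longrightarrow> 0 \<le> b i"
    and cover: "\<And>i k. i \<in> ?U \<Longrightarrow> k \<in> ?K \<Longrightarrow> ?c i k \<le> \<alpha> k + b i"
    and total: "sum \<alpha> ?K + sum b ?U \<le> (\<Sum>k\<in>?K. ?c (f k) k)"
    using assignment_duality[OF finite_index_sets(3,2) ne less_imp_le[OF card], of ?c]
    by blast
  define \<beta> where "\<beta> i = (if i \<in> ?U then b i else 0)" for i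
  define v where "v = - (\<Sum>k\<in>?K. \<alpha> k) - (\<Sum>i\<in>products M. (1 - x i) * \<beta> i)"
  have "(\<Sum>i\<in>products M. (1 - x i) * \<beta> i) = (\<Sum>i\<in>?U. (1 - x i) * \<beta> i)"
    using U_sub by (intro sum.mono_neutral_right finite_index_sets) (auto simp: \<beta>_def)
  also have "\<dots> = sum b ?U"
    using U_iff U_sub by (intro sum.cong) (auto simp: \<beta>_def)
  finally have v_eq: "v = - sum \<alpha> ?K - sum b ?U"
    by (simp add: v_def)
  have pos: "0 < 1 - ?a (f k) k" if "k \<in> ?K" for k
    using a[of "f k" k] f(2) that U_sub by auto
  have "(\<Prod>k\<in>?K. 1 - ?a (f k) k) = (\<Prod>k\<in>?K. exp (- ?c (f k) k))"
    using pos by (intro prod.cong) auto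
  also have "\<dots> = exp (- (\<Sum>k\<in>?K. ?c (f k) k))"
    using finite_index_sets(2) by (simp add: exp_sum sum_negf)
  also have "\<dots> \<le> exp v"
    using total v_eq by simp
  finally have prod: "(\<Prod>k\<in>?K. 1 - ?a (f k) k) \<le> exp v" .
  have bound: "stay_prob M R \<le> exp v"
    if R: "R \<in> feasible_assortments M" and sub: "f ` ?K \<subseteq> unavailable M R" for R
    using stay_prob_le_choice[OF M R injection_priority(1)[OF f(1) sub]]
      injection_priority(2)[OF f(1) sub] prod by linarith
  show ?thesis
  proof (rule that[OF _ v_def])
    have "- ln (1 - ?a i k) * (1 - x i) \<le> \<alpha> k + (1 - x i) * \<beta> i"
      if "i \<in> products M" "k \<in> ?K" for i k
      using U_iff[OF that(1)] \<alpha>[OF that(2)] cover[OF _ that(2), of i] by (auto simp: \<beta>_def)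
    thus "(\<alpha>, \<beta>) \<in> A_set M x"
      using \<alpha> b by (auto simp: A_set_def \<beta>_def)
    have "ln (stay_prob M {}) \<le> ln (exp v)"
      using bound[OF empty] f(2) U_sub stay_prob_bounds(1)[OF M empty]
      by (subst ln_le_cancel_iff) auto
    thus "log_stay M {} \<le> v" by (simp add: log_stay_def)
    show "v \<le> 0"
      unfolding v_eq using \<alpha> b sum_nonneg[of ?K \<alpha>] sum_nonneg[of ?U b] by fastforce
    show "stay_prob M (assortment_of M x) \<le> exp v"
      using bound[OF S f(2)] by (simp add: S_def)
  qed
qed

lemma exact_point_in_relaxation:
  assumes M: "valid_model M" and ex: "exact_feasible M x \<delta> \<pi>'"
  shows "\<exists>\<alpha> \<beta> q w. (x, \<alpha>, \<beta>, \<delta>, q, w, \<pi>') \<in> ub_feasible M T Ss"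
proof -
  from ex have x: "x \<in> X_set M" and \<pi>: "\<pi>' \<le> stay_prob M (assortment_of M x)"
    and rev: "revenue_constraint M x \<delta> \<pi>'"
    by (simp_all add: exact_feasible_def)
  from dual_certificate[OF M x] obtain \<alpha> \<beta> v where A: "(\<alpha>, \<beta>) \<in> A_set M x"
    and v: "v = - (\<Sum>k\<in>positions M. \<alpha> k) - (\<Sum>i\<in>products M. (1 - x i) * \<beta> i)"
    and lo: "log_stay M {} \<le> v" and hi: "v \<le> 0"
    and le: "stay_prob M (assortment_of M x) \<le> exp v" by blast
  let ?\<theta> = "breakpoint M T Ss"
  have "?\<theta> 1 \<le> v" "v \<le> ?\<theta> (T + 2)"
    using lo hi by (simp_all add: breakpoint_def)
  from piecewise_linear_overestimate[OF this] obtain q w :: "nat \<Rightarrow> real" where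
    "\<forall>t\<in>{1..T+2}. 0 \<le> w t \<and> w t \<le> 1" "\<forall>t\<in>{1..T+1}. q t \<in> {0, 1}"
    "w 1 \<le> q 1" "\<forall>t\<in>{2..T+1}. w t \<le> q (t - 1) + q t" "w (T + 2) \<le> q (T + 1)"
    "(\<Sum>t=1..T+1. q t) = 1" "(\<Sum>t=1..T+2. w t) = 1"
    "(\<Sum>t=1..T+2. ?\<theta> t * w t) = v"
    "exp v \<le> (\<Sum>t=1..T+2. exp (?\<theta> t) * w t)" by blast
  hence "(q, w, \<pi>') \<in> Q_set M T Ss x \<alpha> \<beta>"
    unfolding Q_set_def mem_Collect_eq prod.case v[symmetric] using \<pi> le
    by (intro conjI) (assumption | linarith)+
  thus ?thesis using rev x A by (auto simp: ub_feasible_def)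
qed

section \<open>Validity of the inequalities\<close>

text \<open>
  Since every exact point already extends to the upper-bound problem, an inequality is valid as soon as
  the exact points satisfy it.
\<close>

lemma valid_inequalityI:
  assumes "valid_model M" and "\<And>x \<delta> \<pi>'. exact_feasible M x \<delta> \<pi>' \<Longrightarrow> C x \<pi>'"
  shows "valid_inequality M T Ss C"
  using assms exact_point_in_relaxation[OF assms(1)] unfolding valid_inequality_def by blast

lemma stay_prob_le_Max:
  assumes M: "valid_model M" and F: "F \<subseteq> feasible_assortments M" and S: "S \<in> F"
  shows "stay_prob M S \<le> Max (stay_prob M ` F)" and "0 \<le> Max (stay_prob M ` F)"
proof -
  have "finite (feasible_assortments M)"
    by (rule finite_subset[of _ "Pow (products M)"])
      (auto simp: feasible_assortments_def finite_index_sets)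
  hence "finite F" using F finite_subset by blast
  thus le: "stay_prob M S \<le> Max (stay_prob M ` F)"
    using S by (intro Max_ge) auto
  show "0 \<le> Max (stay_prob M ` F)"
    using le stay_prob_bounds(1)[OF M] F S by force
qed

theorem proposition4:
  fixes M :: assort_model and T :: nat and Ss :: "nat \<Rightarrow> nat set"
  assumes "valid_model M"
    and "\<forall>t\<in>{1..T}. Ss t \<in> feasible_assortments M"
    and "\<forall>t\<in>{1..T+1}. breakpoint M T Ss t \<le> breakpoint M T Ss (t + 1)"
  shows "\<forall>i\<in>products M.
           valid_inequality M T Ss (\<lambda>x \<pi>'. \<pi>' \<le> max_stay_with M i + 1 - x i) \<and>
           valid_inequality M T Ss (\<lambda>x \<pi>'. \<pi>' \<le> max_stay_without M i + x i)"
proof (intro ballI conjI; rule valid_inequalityI[OF assms(1)])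
  note M = assms(1)
  fix i x \<delta> \<pi>' assume i: "i \<in> products M" and ex: "exact_feasible M x \<delta> \<pi>'"
  let ?S = "assortment_of M x"
  have x: "x \<in> X_set M" and \<pi>: "\<pi>' \<le> stay_prob M ?S"
    using ex by (simp_all add: exact_feasible_def)
  have S: "?S \<in> feasible_assortments M" by (rule assortment_of_feasible[OF x])
  have x_i: "x i \<in> {0, 1}" "x i = 1 \<longleftrightarrow> i \<in> ?S"
    using x i by (auto simp: X_set_def assortment_of_def)
  have with_sub: "assortments_with M i \<subseteq> feasible_assortments M"
    and without_sub: "assortments_without M i \<subseteq> feasible_assortments M"
    by (auto simp: assortments_with_def assortments_without_def feasible_assortments_def)
  \<comment> \<open>The maxima range over nonempty sets, as \<open>{i}\<close> and \<open>{}\<close> witness; this makes them nonnegative,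
      as the branches with slack 1 require.\<close>
  have "{i} \<in> assortments_with M i"
    using M i by (simp add: assortments_with_def valid_model_def)
  moreover have "{} \<in> assortments_without M i"
    by (simp add: assortments_without_def)
  ultimately have nonneg: "0 \<le> max_stay_with M i" "0 \<le> max_stay_without M i"
    unfolding max_stay_with_def max_stay_without_def
    using stay_prob_le_Max(2)[OF M with_sub] stay_prob_le_Max(2)[OF M without_sub] by blast+
  have le1: "stay_prob M ?S \<le> 1" by (rule stay_prob_bounds(2)[OF M S])
  show "\<pi>' \<le> max_stay_with M i + 1 - x i"
  proof (cases "i \<in> ?S")
    case True
    hence "?S \<in> assortments_with M i"
      using S by (simp add: assortments_with_def feasible_assortments_def)
    thus ?thesis
      using stay_prob_le_Max(1)[OF M with_sub] \<pi> x_i True by (fastforce simp: max_stay_with_def)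
  qed (use x_i \<pi> le1 nonneg in auto)
  show "\<pi>' \<le> max_stay_without M i + x i"
  proof (cases "i \<in> ?S")
    case False
    hence "?S \<in> assortments_without M i"
      using S by (simp add: assortments_without_def feasible_assortments_def)
    thus ?thesis
      using stay_prob_le_Max(1)[OF M without_sub] \<pi> x_i False
      by (fastforce simp: max_stay_without_def)
  qed (use x_i \<pi> le1 nonneg in auto)
qed

end
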